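(* Let $H$ be a real Hilbert space, $m\ge 2$ an integer, and for $j=1,\dots,m$ let $C_j$ be a nonempty closed convex subset of $H$. Let $X:=H^m$, $C:=C_1\times\cdots\times C_m$, and let $R,S,Y,\sigma_C,D$ be as defined in the context. Let $d,e\in Y$ be such that $$\sigma_C(Se)+\langle Sx-Se,e\rangle-\sigma_C(Sx)\le 0\quad\text{for all }x\in X,\qquad\text{and}\qquad d=Se\in D,$$ and let $v=(v_1,\dots,v_m):=-R^{m-1}d$. Then an element $(z_1,\dots,z_m)\in H^m$ is a cycle if, and only if, $$z_i\in C_i\ \text{ for all }i=1,\dots,m,\quad\text{and}\quad z_{i+1}=z_i+v_i\ \text{ for all }i=1,\dots,m-1.$$
   Context: All spaces are real. For $j=1,\dots,m$, $P_j$ denotes the projection (nearest-point map) of $H$ onto $C_j$. An element $z=(z_1,\dots,z_m)\in H^m$ is called a cycle if $z_1=P_1z_m,\ z_2=P_2z_1,\ \dots,\ z_m=P_mz_{m-1}$. $X=H^m$ carries the Hilbert space structure $\langle x,y\rangle=\sum_{i=1}^m\langle x_i,y_i\rangle$. $R\colon X\to X$ is the cyclic shift $R(x_1,x_2,\dots,x_m):=(x_m,x_1,\dots,x_{m-1})$, and $S:=R-I_X$, so $S(x_1,\dots,x_m)=(x_m-x_1,x_1-x_2,\dots,x_{m-1}-x_m)$. $Y:=\{y\in X:\ \frac1m\sum_{i=1}^mR^iy=0\}=\{y\in X:\ \sum_{i=1}^m y_i=0\}$. The support function of $C$ is $\sigma_C(t):=\sup_{c\in C}\langle c,t\rangle\in(-\infty,+\infty]$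 (an inequality $a-\sigma_C(Sx)\le0$ with $a$ real is regarded as true when $\sigma_C(Sx)=+\infty$). $D:=\{y\in Y:\ \sigma_C(y)+\frac12\|y\|^2\le0\}$. *)

theory Defs
  imports "HOL-Analysis.Analysis"
begin

(* A real Hilbert space is a type of class {real_inner, complete_space}.
   The library's closest_point is restricted to class heine_borel, i.e. to locally compact
   spaces, so the nearest-point map is defined here for arbitrary metric spaces. For a nonempty
   closed convex subset of a Hilbert space the description picks out exactly one point. *)

definition nearest :: "'a::metric_space set \<Rightarrow> 'a \<Rightarrow> 'a" where
  "nearest K x = (THE p. p \<in> K \<and> (\<forall>q\<in>K. dist x p \<le> dist x q))"

(* An m-tuple is encoded as a family indexed by nat that vanishes outside {1..m}, so that
   equality of families is equality of m-tuples and the pointwise operations on functions stay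
   within the set. *)

definition pow_space :: "nat \<Rightarrow> (nat \<Rightarrow> 'a::real_inner) set" where
  "pow_space m = {x. \<forall>i. i \<notin> {1..m} \<longrightarrow> x i = 0}"

definition pow_inner :: "nat \<Rightarrow> (nat \<Rightarrow> 'a::real_inner) \<Rightarrow> (nat \<Rightarrow> 'a) \<Rightarrow> real" where
  "pow_inner m x y = (\<Sum>i=1..m. x i \<bullet> y i)"

definition pow_norm :: "nat \<Rightarrow> (nat \<Rightarrow> 'a::real_inner) \<Rightarrow> real" where
  "pow_norm m x = sqrt (pow_inner m x x)"

definition prod_set :: "nat \<Rightarrow> (nat \<Rightarrow> 'a::real_inner set) \<Rightarrow> (nat \<Rightarrow> 'a) set" where
  "prod_set m C = {x \<in> pow_space m. \<forall>i\<in>{1..m}. x i \<in> C i}"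

definition shift :: "nat \<Rightarrow> (nat \<Rightarrow> 'a::real_inner) \<Rightarrow> nat \<Rightarrow> 'a" where
  "shift m x = (\<lambda>i. if i = 1 then x m else if i \<in> {2..m} then x (i - 1) else 0)"

(* Binary and unary minus on functions are pointwise. *)

definition shift_diff :: "nat \<Rightarrow> (nat \<Rightarrow> 'a::real_inner) \<Rightarrow> nat \<Rightarrow> 'a" where
  "shift_diff m x = shift m x - x"

definition zero_mean :: "nat \<Rightarrow> (nat \<Rightarrow> 'a::real_inner) set" where
  "zero_mean m =
    {y \<in> pow_space m. \<forall>j. (1 / real m) *\<^sub>R (\<Sum>i=1..m. (shift m ^^ i) y j) = 0}"

definition support_fun :: "nat \<Rightarrow> (nat \<Rightarrow> 'a::real_inner) set \<Rightarrow> (nat \<Rightarrow> 'a) \<Rightarrow> ereal" where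
  "support_fun m K t = (SUP c\<in>K. ereal (pow_inner m c t))"

definition D_set :: "nat \<Rightarrow> (nat \<Rightarrow> 'a::real_inner set) \<Rightarrow> (nat \<Rightarrow> 'a) set" where
  "D_set m C = {y \<in> zero_mean m.
    support_fun m (prod_set m C) y + ereal (1 / 2 * (pow_norm m y)\<^sup>2) \<le> 0}"

definition is_cycle :: "nat \<Rightarrow> (nat \<Rightarrow> 'a::real_inner set) \<Rightarrow> (nat \<Rightarrow> 'a) \<Rightarrow> bool" where
  "is_cycle m C z \<longleftrightarrow> z \<in> pow_space m \<and> z 1 = nearest (C 1) (z m) \<and>
    (\<forall>i\<in>{2..m}. z i = nearest (C i) (z (i - 1)))"

lemma shift_pow:
  assumes "i \<le> m"
  shows "(shift m ^^ i) y j =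
    (if j \<in> {1..m} then (if i < j then y (j - i) else y (m + j - i)) else if i = 0 then y j else 0)"
  using assms
proof (induction i arbitrary: j)
  case 0
  then show ?case by auto
next
  case (Suc i)
  show ?case
    using Suc by (auto simp: shift_def Suc_diff_le not_less le_Suc_eq intro!: arg_cong[of _ _ y])
qed

lemma zero_mean_eq:
  assumes "m \<ge> 1"
  shows "zero_mean m = {y :: nat \<Rightarrow> 'a::real_inner. y \<in> pow_space m \<and> (\<Sum>i=1..m. y i) = 0}"
proof -
  have *: "(\<Sum>i=1..m. (shift m ^^ i) y j) = (if j \<in> {1..m} then \<Sum>i=1..m. y i else 0)"
    if y: "y \<in> pow_space m" for y :: "nat \<Rightarrow> 'a" and j
  proof -
    have full: "(shift m ^^ m) y j = (shift m ^^ 0) y j"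
      using y assms by (auto simp: shift_pow pow_space_def)
    have "(\<Sum>i=1..m. (shift m ^^ i) y j) = (\<Sum>i<m. (shift m ^^ i) y j)"
    proof -
      have "{1..m} = insert m {1..<m}" "{..<m} = insert 0 {1..<m}" using assms by auto
      then show ?thesis using full assms by simp
    qed
    also have "\<dots> = (if j \<in> {1..m} then \<Sum>i=1..m. y i else 0)"
    proof (cases "j \<in> {1..m}")
      case True
      have "(\<Sum>i<m. (shift m ^^ i) y j) = (\<Sum>i<m. y (if i < j then j - i else m + j - i))"
        using True by (intro sum.cong) (auto simp: shift_pow)
      also have "\<dots> = (\<Sum>i=1..m. y i)"
        using True
        by (intro sum.reindex_bij_witness[of _ "\<lambda>k. if k \<le> j then j - k else m + j - k"
              "\<lambda>i. if i < j then j - i else m + j - i"]) auto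
      finally show ?thesis using True by simp
    next
      case False
      then have "(shift m ^^ i) y j = 0" if "i < m" for i
        using y that shift_pow[of i m y j] by (auto simp: pow_space_def)
      then show ?thesis using False by auto
    qed
    finally show ?thesis .
  qed
  have "(\<forall>j. (1 / real m) *\<^sub>R (\<Sum>i=1..m. (shift m ^^ i) y j) = 0) \<longleftrightarrow> (\<Sum>i=1..m. y i) = 0"
    if "y \<in> pow_space m" for y :: "nat \<Rightarrow> 'a"
    unfolding *[OF that] using assms by auto
  then show ?thesis
    unfolding zero_mean_def by blast
qed

end

theory Submission
  imports Defs
begin

text \<open>
  By the variational characterization of projections, \<open>z\<close> is a cycle iff \<open>z \<in> C\<close> and
  \<open>\<sigma>(S z) \<le> \<langle>z, S z\<rangle>\<close>. Since \<open>R\<close> is an isometry, \<open>\<langle>S x, y\<rangle> + \<langle>x, S y\<rangle> = - \<langle>S x, S y\<rangle>\<close>; in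
  particular \<open>\<langle>z, S z\<rangle> = - \<parallel>S z\<parallel>\<^sup>2 / 2\<close>. The condition on \<open>v\<close> says \<open>S z = d\<close>, so \<open>d \<in> D\<close> gives one
  direction. For the other, let \<open>y = S z\<close> for a cycle \<open>z\<close>. Evaluating the subgradient inequality
  at \<open>2 e\<close> and using homogeneity of \<open>\<sigma>\<close> gives \<open>\<sigma>(d) \<ge> \<langle>d, e\<rangle>\<close>, hence
  \<open>\<langle>y, e\<rangle> \<le> \<sigma>(y) \<le> - \<parallel>y\<parallel>\<^sup>2 / 2\<close>; also \<open>\<langle>z, d\<rangle> \<le> \<sigma>(d) \<le> - \<parallel>d\<parallel>\<^sup>2 / 2\<close>. Adding these,
  \<open>- \<langle>y, d\<rangle> \<le> - \<parallel>y\<parallel>\<^sup>2 / 2 - \<parallel>d\<parallel>\<^sup>2 / 2\<close>, so \<open>\<parallel>y - d\<parallel>\<^sup>2 \<le> 0\<close>.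
\<close>

section \<open>Nearest points of closed convex sets in a Hilbert space\<close>

lemma nearest_point_exists:
  fixes K :: "'a::{real_inner, complete_space} set"
  assumes "K \<noteq> {}" "closed K" "convex K"
  shows "\<exists>p\<in>K. \<forall>q\<in>K. dist x p \<le> dist x q"
proof -
  define \<delta> where "\<delta> = infdist x K"
  have \<delta>: "\<delta> \<le> dist x q" if "q \<in> K" for q
    using that by (simp add: \<delta>_def infdist_le)
  have \<delta>0: "\<delta> \<ge> 0" by (simp add: \<delta>_def infdist_nonneg)
  \<comment> \<open>Nested closed sets of near-minimizers: once their diameters are shown to tend to
    zero, completeness gives a common point. The slack is added to the squared distance to suit the
    parallelogram law.\<close>
  define A where "A n = {q \<in> K. (dist x q)\<^sup>2 \<le> \<delta>\<^sup>2 + 1 / real (Suc n)}" for n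
  have A_closed: "closed (A n)" for n
  proof -
    have "A n = K \<inter> {q. (dist x q)\<^sup>2 \<le> \<delta>\<^sup>2 + 1 / real (Suc n)}" by (auto simp: A_def)
    moreover have "closed {q. (dist x q)\<^sup>2 \<le> \<delta>\<^sup>2 + 1 / real (Suc n)}"
      by (intro closed_Collect_le continuous_intros)
    ultimately show ?thesis using assms(2) by (simp add: closed_Int)
  qed
  have A_nonempty: "A n \<noteq> {}" for n
  proof -
    have "\<delta> < sqrt (\<delta>\<^sup>2 + 1 / real (Suc n))"
      by (rule real_less_rsqrt) simp
    then obtain q where "q \<in> K" "dist x q < sqrt (\<delta>\<^sup>2 + 1 / real (Suc n))"
      using assms(1) by (auto simp: \<delta>_def infdist_notempty cINF_less_iff)
    then have "(dist x q)\<^sup>2 \<le> (sqrt (\<delta>\<^sup>2 + 1 / real (Suc n)))\<^sup>2"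
      by (intro power_mono) auto
    with \<open>q \<in> K\<close> show ?thesis by (auto simp: A_def)
  qed
  have A_diam: "(dist p q)\<^sup>2 \<le> 4 / real (Suc n)" if "p \<in> A n" "q \<in> A n" for p q n
  proof -
    have "p \<in> K" "q \<in> K" using that by (auto simp: A_def)
    then have "(1/2) *\<^sub>R p + (1/2) *\<^sub>R q \<in> K"
      using convexD[OF assms(3), of p q "1/2" "1/2"] by simp
    then have "\<delta>\<^sup>2 \<le> (dist x ((1/2) *\<^sub>R p + (1/2) *\<^sub>R q))\<^sup>2"
      using \<delta> \<delta>0 by (intro power_mono) auto
    \<comment> \<open>Parallelogram law for \<open>x - p\<close> and \<open>x - q\<close>. The
      midpoint stays in \<open>K\<close>, so its distance is at least \<open>\<delta>\<close>, and
      only the slack is left for \<open>dist p q\<close>.\<close>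
    moreover have "(dist p q)\<^sup>2 + 4 * (dist x ((1/2) *\<^sub>R p + (1/2) *\<^sub>R q))\<^sup>2
        = 2 * (dist x p)\<^sup>2 + 2 * (dist x q)\<^sup>2"
      by (simp add: dist_norm power2_norm_eq_inner inner_diff_left inner_diff_right
          inner_add_left inner_add_right inner_commute algebra_simps)
    moreover have "(dist x p)\<^sup>2 \<le> \<delta>\<^sup>2 + 1 / real (Suc n)" "(dist x q)\<^sup>2 \<le> \<delta>\<^sup>2 + 1 / real (Suc n)"
      using that by (auto simp: A_def)
    ultimately show ?thesis by simp
  qed
  have A_small: "\<exists>n. \<forall>p\<in>A n. \<forall>q\<in>A n. dist p q < \<epsilon>" if "\<epsilon> > 0" for \<epsilon> :: real
  proof -
    obtain n where n: "inverse (real (Suc n)) < \<epsilon>\<^sup>2 / 4"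
      using reals_Archimedean[of "\<epsilon>\<^sup>2 / 4"] \<open>\<epsilon> > 0\<close> by auto
    have "dist p q < \<epsilon>" if "p \<in> A n" "q \<in> A n" for p q
      using A_diam[OF that] n \<open>\<epsilon> > 0\<close>
      by (intro power2_less_imp_less[of "dist p q" \<epsilon>]) (auto simp: inverse_eq_divide)
    then show ?thesis by blast
  qed
  have A_mono: "A n \<subseteq> A k" if "k \<le> n" for k n
  proof -
    have "1 / real (Suc n) \<le> 1 / real (Suc k)" using that by (simp add: frac_le)
    then show ?thesis by (auto simp: A_def)
  qed
  obtain p where p: "\<And>n. p \<in> A n"
    using decreasing_closed_nest[of A, OF A_closed A_nonempty A_mono A_small] by blast
  have "(dist x p)\<^sup>2 \<le> \<delta>\<^sup>2"
  proof (rule field_le_epsilon)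
    fix \<epsilon> :: real assume "\<epsilon> > 0"
    then obtain n where "inverse (real (Suc n)) < \<epsilon>" using reals_Archimedean by blast
    with p[of n] show "(dist x p)\<^sup>2 \<le> \<delta>\<^sup>2 + \<epsilon>" by (auto simp: A_def inverse_eq_divide)
  qed
  then have "dist x p \<le> \<delta>" using \<delta>0 power2_le_imp_le by blast
  then show ?thesis using p \<delta> by (force simp: A_def)
qed

text \<open>If the inner product were positive, a short move from \<open>p\<close> towards
  \<open>q\<close> would come closer to \<open>x\<close>. Conversely, expanding the squared distance
  from \<open>x\<close> to \<open>q\<close> around \<open>p\<close> leaves only nonnegative extra
  terms.\<close>

lemma nearest_point_iff:
  fixes K :: "'a::real_inner set"
  assumes "convex K" "p \<in> K"
  shows "(\<forall>q\<in>K. dist x p \<le> dist x q) \<longleftrightarrow> (\<forall>q\<in>K. (q - p) \<bullet> (x - p) \<le> 0)"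
proof
  assume min: "\<forall>q\<in>K. dist x p \<le> dist x q"
  show "\<forall>q\<in>K. (q - p) \<bullet> (x - p) \<le> 0"
  proof (rule ballI, rule ccontr)
    fix q assume "q \<in> K" and "\<not> (q - p) \<bullet> (x - p) \<le> 0"
    then have pos: "(x - p) \<bullet> (q - p) > 0" by (simp add: inner_commute)
    obtain u where u: "u > 0" "u \<le> 1" "dist (p + u *\<^sub>R (q - p)) x < dist p x"
      using closer_point_lemma[OF pos] by (auto simp: dist_commute)
    have "p + u *\<^sub>R (q - p) = (1 - u) *\<^sub>R p + u *\<^sub>R q"
      by (simp add: algebra_simps)
    also have "\<dots> \<in> K"
      using assms \<open>q \<in> K\<close> u by (intro convexD) auto
    finally show False using min u by (metis dist_commute not_le)
  qed
next
  assume var: "\<forall>q\<in>K. (q - p) \<bullet> (x - p) \<le> 0"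
  show "\<forall>q\<in>K. dist x p \<le> dist x q"
  proof
    fix q assume "q \<in> K"
    have "(dist x q)\<^sup>2 = (dist x p)\<^sup>2 + (dist p q)\<^sup>2 - 2 * ((q - p) \<bullet> (x - p))"
      by (simp add: dist_norm power2_norm_eq_inner inner_diff_left inner_diff_right
          inner_commute algebra_simps)
    then have "(dist x p)\<^sup>2 \<le> (dist x q)\<^sup>2"
      using var \<open>q \<in> K\<close> by (smt (verit) zero_le_power2)
    then show "dist x p \<le> dist x q" using power2_le_imp_le zero_le_dist by blast
  qed
qed

text \<open>Testing the variational inequalities of two minimizers at each other and adding them
  forces the minimizers to coincide, so the description in \<open>nearest\<close> denotes.\<close>

lemma eq_nearest_iff:
  fixes K :: "'a::{real_inner, complete_space} set"
  assumes "K \<noteq> {}" "closed K" "convex K"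
  shows "p = nearest K x \<longleftrightarrow> p \<in> K \<and> (\<forall>q\<in>K. (q - p) \<bullet> (x - p) \<le> 0)"
proof -
  let ?Q = "\<lambda>p. p \<in> K \<and> (\<forall>q\<in>K. dist x p \<le> dist x q)"
  have Q_iff: "?Q p \<longleftrightarrow> p \<in> K \<and> (\<forall>q\<in>K. (q - p) \<bullet> (x - p) \<le> 0)" for p
    using nearest_point_iff[OF assms(3)] by blast
  have uniq: "p = p'" if "?Q p" "?Q p'" for p p'
  proof -
    have "(p' - p) \<bullet> (x - p) \<le> 0" "(p - p') \<bullet> (x - p') \<le> 0"
      using that Q_iff by blast+
    then have "(p - p') \<bullet> (p - p') \<le> 0"
      by (simp add: inner_diff_left inner_diff_right inner_commute)
    then show ?thesis by (metis inner_gt_zero_iff not_le right_minus_eq)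
  qed
  have ex1: "\<exists>!p. ?Q p"
    using nearest_point_exists[OF assms] uniq by blast
  have "p = nearest K x \<longleftrightarrow> ?Q p"
    unfolding nearest_def using theI'[OF ex1] the1_equality[OF ex1] by blast
  with Q_iff show ?thesis by blast
qed

section \<open>The inner product on the power and the cyclic shift\<close>

lemma pow_inner_diff_left: "pow_inner m (x - y) z = pow_inner m x z - pow_inner m y z"
  by (simp add: pow_inner_def inner_diff_left sum_subtractf)

lemma pow_inner_commute: "pow_inner m x y = pow_inner m y x"
  by (simp add: pow_inner_def inner_commute)

lemma pow_inner_diff_right: "pow_inner m x (y - z) = pow_inner m x y - pow_inner m x z"
  by (simp add: pow_inner_def inner_diff_right sum_subtractf)

lemma pow_inner_scaleR_left: "pow_inner m (\<lambda>i. a *\<^sub>R x i) y = a * pow_inner m x y"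
  by (simp add: pow_inner_def sum_distrib_left)

lemma pow_inner_scaleR_right: "pow_inner m x (\<lambda>i. a *\<^sub>R y i) = a * pow_inner m x y"
  by (simp add: pow_inner_def sum_distrib_left)

lemma pow_inner_nonneg: "0 \<le> pow_inner m x x"
  by (simp add: pow_inner_def sum_nonneg)

lemma pow_inner_self_le_zero_imp:
  assumes "pow_inner m x x \<le> 0" "i \<in> {1..m}"
  shows "x i = 0"
proof -
  have "(\<Sum>i=1..m. x i \<bullet> x i) = 0"
    using assms pow_inner_nonneg[of m x] by (simp add: pow_inner_def)
  then show ?thesis using assms(2) by (simp add: sum_nonneg_eq_0_iff)
qed

lemma sum_cyclic_shift:
  fixes f :: "nat \<Rightarrow> 'b::comm_monoid_add"
  assumes "m \<ge> 1"
  shows "(\<Sum>i=1..m. if i = 1 then f m else f (i - 1)) = (\<Sum>i=1..m. f i)"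
  using assms
  by (intro sum.reindex_bij_witness[of _ "\<lambda>i. if i = m then 1 else i + 1"
        "\<lambda>i. if i = 1 then m else i - 1"]) auto

lemma pow_inner_shift:
  assumes "m \<ge> 1"
  shows "pow_inner m (shift m x) (shift m y) = pow_inner m x y"
proof -
  have "pow_inner m (shift m x) (shift m y)
      = (\<Sum>i=1..m. if i = 1 then x m \<bullet> y m else x (i - 1) \<bullet> y (i - 1))"
    unfolding pow_inner_def by (intro sum.cong) (auto simp: shift_def)
  also have "\<dots> = pow_inner m x y"
    unfolding pow_inner_def by (rule sum_cyclic_shift[OF assms, of "\<lambda>i. x i \<bullet> y i"])
  finally show ?thesis .
qed

lemma sum_shift_diff:
  assumes "m \<ge> 1"
  shows "(\<Sum>i=1..m. shift_diff m x i) = 0"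
proof -
  have "(\<Sum>i=1..m. shift m x i) = (\<Sum>i=1..m. if i = 1 then x m else x (i - 1))"
    by (intro sum.cong) (auto simp: shift_def)
  also have "\<dots> = (\<Sum>i=1..m. x i)" by (rule sum_cyclic_shift[OF assms])
  finally show ?thesis by (simp add: shift_diff_def sum_subtractf)
qed

lemma shift_diff_scaleR: "shift_diff m (\<lambda>i. a *\<^sub>R x i) = (\<lambda>i. a *\<^sub>R shift_diff m x i)"
  by (auto simp: shift_diff_def shift_def scaleR_diff_right)

lemma shift_diff_in_pow_space:
  assumes "m \<ge> 1" "x \<in> pow_space m"
  shows "shift_diff m x \<in> pow_space m"
  using assms by (auto simp: shift_diff_def shift_def pow_space_def)

lemma pow_inner_shift_diff_add:
  assumes "m \<ge> 1"
  shows "pow_inner m (shift_diff m x) y + pow_inner m x (shift_diff m y)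
    = - pow_inner m (shift_diff m x) (shift_diff m y)"
  using pow_inner_shift[OF assms, of x y]
  by (simp add: shift_diff_def pow_inner_diff_left pow_inner_diff_right)

lemma pow_inner_self_shift_diff:
  assumes "m \<ge> 1"
  shows "pow_inner m x (shift_diff m x)
    = - (1/2) * pow_inner m (shift_diff m x) (shift_diff m x)"
  using pow_inner_shift_diff_add[OF assms, of x x]
  by (simp add: pow_inner_commute[of m "shift_diff m x" x])

section \<open>Support functions and the two reformulations of the claim\<close>

lemma pow_inner_le_support_fun:
  "c \<in> K \<Longrightarrow> ereal (pow_inner m c t) \<le> support_fun m K t"
  unfolding support_fun_def by (rule SUP_upper)

lemma support_fun_le:
  "(\<And>c. c \<in> K \<Longrightarrow> pow_inner m c t \<le> a) \<Longrightarrow> support_fun m K t \<le> ereal a"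
  unfolding support_fun_def by (rule SUP_least) simp

text \<open>Entry \<open>i\<close> of \<open>shift_diff m z\<close> points from \<open>z i\<close>
  to the point projected onto \<open>C i\<close>, so the inequalities of the m projections add up to
  a single one over the product. It says that \<open>z\<close> attains the support function at
  \<open>shift_diff m z\<close>.\<close>

lemma is_cycle_iff_variational:
  fixes C :: "nat \<Rightarrow> 'a::{real_inner, complete_space} set"
  assumes "m \<ge> 1" "\<And>j. j \<in> {1..m} \<Longrightarrow> C j \<noteq> {}" "\<And>j. j \<in> {1..m} \<Longrightarrow> closed (C j)"
    "\<And>j. j \<in> {1..m} \<Longrightarrow> convex (C j)" and z: "z \<in> pow_space m"
  shows "is_cycle m C z \<longleftrightarrow> z \<in> prod_set m C \<and>
    (\<forall>c\<in>prod_set m C. pow_inner m c (shift_diff m z) \<le> pow_inner m z (shift_diff m z))"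
    (is "_ \<longleftrightarrow> _ \<and> ?V")
proof -
  have "is_cycle m C z \<longleftrightarrow> (\<forall>i\<in>{1..m}. z i = nearest (C i) (shift m z i))"
  proof -
    have "{1..m} = insert 1 {2..m}" using assms(1) by auto
    then show ?thesis using z by (auto simp: is_cycle_def shift_def)
  qed
  also have "\<dots> \<longleftrightarrow> (\<forall>i\<in>{1..m}. z i \<in> C i \<and> (\<forall>q\<in>C i. (q - z i) \<bullet> shift_diff m z i \<le> 0))"
    unfolding shift_diff_def minus_apply
    by (intro ball_cong refl eq_nearest_iff assms(2-4))
  also have "\<dots> \<longleftrightarrow> z \<in> prod_set m C \<and> ?V"
  proof (intro iffI conjI ballI)
    assume *: "\<forall>i\<in>{1..m}. z i \<in> C i \<and> (\<forall>q\<in>C i. (q - z i) \<bullet> shift_diff m z i \<le> 0)"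
    then show "z \<in> prod_set m C" using z by (auto simp: prod_set_def)
    fix c assume "c \<in> prod_set m C"
    then have "pow_inner m (c - z) (shift_diff m z) \<le> 0"
      unfolding pow_inner_def using * by (intro sum_nonpos) (auto simp: prod_set_def)
    then show "pow_inner m c (shift_diff m z) \<le> pow_inner m z (shift_diff m z)"
      by (simp add: pow_inner_diff_left)
  next
    fix i assume *: "z \<in> prod_set m C \<and> ?V" and i: "i \<in> {1..m}"
    then show "z i \<in> C i" by (auto simp: prod_set_def)
    fix q assume "q \<in> C i"
    \<comment> \<open>In a product set one coordinate can vary alone, which isolates the inequality
      for \<open>C i\<close>.\<close>
    then have "z(i := q) \<in> prod_set m C"
      using * i by (auto simp: prod_set_def pow_space_def)
    then have "pow_inner m (z(i := q) - z) (shift_diff m z) \<le> 0"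
      using * by (simp add: pow_inner_diff_left)
    moreover have "pow_inner m (z(i := q) - z) (shift_diff m z)
        = (\<Sum>j=1..m. if j = i then (q - z i) \<bullet> shift_diff m z i else 0)"
      unfolding pow_inner_def by (intro sum.cong) auto
    ultimately show "(q - z i) \<bullet> shift_diff m z i \<le> 0" using i by simp
  qed
  finally show ?thesis .
qed

text \<open>The step equations are the entries 2 to m of \<open>shift_diff m z = d\<close>; the
  first entry follows because both sides sum to zero.\<close>

lemma shift_diff_eq_iff_steps:
  assumes "m \<ge> 2" and z: "z \<in> pow_space m" and d: "d \<in> zero_mean m"
    and v: "v = - (shift m ^^ (m - 1)) d"
  shows "shift_diff m z = d \<longleftrightarrow> (\<forall>i\<in>{1..m - 1}. z (i + 1) = z i + v i)"
proof -
  have dp: "d \<in> pow_space m" and ds: "(\<Sum>i=1..m. d i) = 0"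
    using d zero_mean_eq[of m] assms(1) by auto
  \<comment> \<open>Shifting m - 1 times is shifting back once; for \<open>i\<close> below m the
    index does not wrap around.\<close>
  have vi: "v i = - d (i + 1)" if "i \<in> {1..m - 1}" for i
  proof -
    have "m + i - (m - 1) = i + 1" "\<not> m - 1 < i" "i \<in> {1..m}" using that assms(1) by auto
    then show ?thesis by (simp add: v shift_pow)
  qed
  have si: "shift_diff m z (i + 1) = z i - z (i + 1)" if "i \<in> {1..m - 1}" for i
    using that assms(1) by (auto simp: shift_diff_def shift_def)
  have "shift_diff m z = d" if eq: "\<forall>i\<in>{1..m - 1}. z (i + 1) = z i + v i"
  proof -
    have eq2: "shift_diff m z j = d j" if "j \<in> {2..m}" for j
    proof -
      have "j - 1 \<in> {1..m - 1}" "j - 1 + 1 = j" using that by auto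
      with bspec[OF eq, of "j - 1"] vi[of "j - 1"] si[of "j - 1"] show ?thesis by simp
    qed
    have I: "{1..m} = insert 1 {2..m}" using assms(1) by auto
    have "shift_diff m z 1 + (\<Sum>i=2..m. shift_diff m z i) = d 1 + (\<Sum>i=2..m. d i)"
      using sum_shift_diff[of m z] ds assms(1) unfolding I by simp
    moreover have "(\<Sum>i=2..m. shift_diff m z i) = (\<Sum>i=2..m. d i)"
      using eq2 by (intro sum.cong) auto
    ultimately have "shift_diff m z 1 = d 1" by simp
    then have "shift_diff m z j = d j" for j
      using eq2 I dp shift_diff_in_pow_space[of m z] z assms(1)
      by (cases "j \<in> {1..m}") (auto simp: pow_space_def)
    then show ?thesis by blast
  qed
  moreover have "\<forall>i\<in>{1..m - 1}. z (i + 1) = z i + v i" if "shift_diff m z = d"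
    using si vi that by force
  ultimately show ?thesis by blast
qed

theorem theorem9:
  fixes C :: "nat \<Rightarrow> 'a::{real_inner, complete_space} set"
    and m :: nat
    and d e v z :: "nat \<Rightarrow> 'a"
  assumes "m \<ge> 2"
    and "\<And>j. j \<in> {1..m} \<Longrightarrow> C j \<noteq> {}"
    and "\<And>j. j \<in> {1..m} \<Longrightarrow> closed (C j)"
    and "\<And>j. j \<in> {1..m} \<Longrightarrow> convex (C j)"
    and "d \<in> zero_mean m" and "e \<in> zero_mean m"
    and "\<And>x. x \<in> pow_space m \<Longrightarrow>
      support_fun m (prod_set m C) (shift_diff m e)
        + ereal (pow_inner m (shift_diff m x - shift_diff m e) e)
        - support_fun m (prod_set m C) (shift_diff m x) \<le> 0"
    and "d = shift_diff m e" and "d \<in> D_set m C"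
    and "v = - (shift m ^^ (m - 1)) d"
    and "z \<in> pow_space m"
  shows "is_cycle m C z \<longleftrightarrow>
    (\<forall>i\<in>{1..m}. z i \<in> C i) \<and> (\<forall>i\<in>{1..m - 1}. z (i + 1) = z i + v i)"
proof -
  let ?S = "shift_diff m" and ?C = "prod_set m C"
  let ?\<sigma> = "support_fun m ?C"
  have m: "m \<ge> 1" using assms(1) by simp
  note cyc = is_cycle_iff_variational[where C = C, OF m assms(2-4,11)]
  note half = pow_inner_self_shift_diff[OF m]
  have "\<forall>j\<in>{1..m}. \<exists>c. c \<in> C j" using assms(2) by blast
  then obtain c0 where c0: "\<And>j. j \<in> {1..m} \<Longrightarrow> c0 j \<in> C j" by metis
  have "(\<lambda>i. if i \<in> {1..m} then c0 i else 0) \<in> ?C"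
    using c0 by (auto simp: prod_set_def pow_space_def)
  from pow_inner_le_support_fun[OF this, of m d] have lower: "?\<sigma> d \<noteq> -\<infinity>" by auto
  have D: "?\<sigma> d + ereal (1/2 * pow_inner m d d) \<le> 0"
    using assms(9) pow_inner_nonneg[of m d] by (simp add: D_set_def pow_norm_def)
  \<comment> \<open>A point of the product excludes \<open>-\<infinity>\<close> and membership of
    \<open>d\<close> in \<open>D_set m C\<close> excludes \<open>\<infinity>\<close>, so the support
    function is real at \<open>d\<close>.\<close>
  with lower obtain s where s: "?\<sigma> d = ereal s" by (cases "?\<sigma> d") auto
  have s_le: "s \<le> - (1/2) * pow_inner m d d" using D s by simp
  have le_s: "pow_inner m c d \<le> s" if "c \<in> ?C" for c
    using pow_inner_le_support_fun[OF that, of m d] s by simp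
  \<comment> \<open>The real bound \<open>b\<close> rules out the value \<open>\<infinity>\<close>,
    at which the subgradient inequality says nothing.\<close>
  have sub: "s + pow_inner m (?S x - d) e \<le> b"
    if "x \<in> pow_space m" "?\<sigma> (?S x) \<le> ereal b" for x b
  proof -
    have "ereal s + ereal (pow_inner m (?S x - d) e) - ?\<sigma> (?S x) \<le> 0"
      using assms(7)[OF that(1)] s assms(8) by simp
    with that(2) show ?thesis by (cases "?\<sigma> (?S x)") auto
  qed
  have e: "e \<in> pow_space m" using assms(6) zero_mean_def by blast
  have s_ge: "s \<ge> pow_inner m d e"
  proof -
    have S2: "?S (\<lambda>i. 2 *\<^sub>R e i) = (\<lambda>i. 2 *\<^sub>R d i)"
      using shift_diff_scaleR assms(8) by blast
    have "?\<sigma> (\<lambda>i. 2 *\<^sub>R d i) \<le> ereal (2 * s)"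
      using le_s by (intro support_fun_le) (simp add: pow_inner_scaleR_right)
    then have "s + pow_inner m ((\<lambda>i. 2 *\<^sub>R d i) - d) e \<le> 2 * s"
      using sub[of "\<lambda>i. 2 *\<^sub>R e i" "2 * s"] S2 e by (simp add: pow_space_def)
    then show ?thesis by (simp add: pow_inner_diff_left pow_inner_scaleR_left)
  qed
  have "is_cycle m C z \<longleftrightarrow> z \<in> ?C \<and> ?S z = d"
  proof
    assume "is_cycle m C z"
    then have zC: "z \<in> ?C"
      and max: "\<And>c. c \<in> ?C \<Longrightarrow> pow_inner m c (?S z) \<le> pow_inner m z (?S z)"
      using cyc by auto
    \<comment> \<open>By \<open>max\<close> and \<open>half\<close>, the right-hand side bounds the
      support function at \<open>?S z\<close>, so it can serve as \<open>b\<close>.\<close>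
    have "s + pow_inner m (?S z - d) e \<le> - (1/2) * pow_inner m (?S z) (?S z)"
      using max half[of z] by (intro sub[OF assms(11)] support_fun_le) simp
    then have "pow_inner m (?S z) e \<le> - (1/2) * pow_inner m (?S z) (?S z)"
      using s_ge by (simp add: pow_inner_diff_left)
    moreover have "pow_inner m z d \<le> - (1/2) * pow_inner m d d"
      using le_s[OF zC] s_le by simp
    moreover have "pow_inner m (?S z) e + pow_inner m z d = - pow_inner m (?S z) d"
      using pow_inner_shift_diff_add[OF m, of z e] assms(8) by simp
    ultimately have le: "pow_inner m (?S z - d) (?S z - d) \<le> 0"
      by (simp add: pow_inner_diff_left pow_inner_diff_right pow_inner_commute[of m d "?S z"])
    have "?S z i = d i" for i
    proof (cases "i \<in> {1..m}")
      case True
      from pow_inner_self_le_zero_imp[OF le this] show ?thesis by simp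
    next
      case False
      then show ?thesis
        using shift_diff_in_pow_space[OF m assms(11)] shift_diff_in_pow_space[OF m e] assms(8)
        by (auto simp: pow_space_def)
    qed
    with zC show "z \<in> ?C \<and> ?S z = d" by blast
  next
    assume "z \<in> ?C \<and> ?S z = d"
    then have zC: "z \<in> ?C" and Sz: "?S z = d" by auto
    \<comment> \<open>By \<open>half\<close>, \<open>pow_inner m z d\<close> equals the upper bound
      on \<open>s\<close> in \<open>s_le\<close>; hence \<open>z\<close> attains the support
      function at \<open>d\<close>.\<close>
    have "s \<le> pow_inner m z d" using s_le half[of z] Sz by simp
    then have "pow_inner m c d \<le> pow_inner m z d" if "c \<in> ?C" for c
      using le_s[OF that] by simp
    then show "is_cycle m C z"
      using cyc Sz zC by simp
  qed
  also have "\<dots> \<longleftrightarrow> (\<forall>i\<in>{1..m}. z i \<in> C i) \<and> (\<forall>i\<in>{1..m - 1}. z (i + 1) = z i + v i)"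
    using shift_diff_eq_iff_steps[OF assms(1,11,5,10)] assms(11) by (simp add: prod_set_def)
  finally show ?thesis .
qed

end
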